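(* Let $1\leq m<n$ be integers. For all $s\in(m,n]$ and $t\in(0,s)$ there exists a compact set $F\subset\mathbb{R}^n$ such that $\dim_{\mathrm P}F=\overline{\dim}_{\mathrm B}F=t$, $\dim_{\mathrm A}F=s$ (in particular, $\dim_{\mathrm{qA}}F\leq s$), and $$\dim_{\mathrm P}\pi_VF\ \leq\ \overline{\dim}_{\mathrm B}\,\pi_VF\ \leq\ \frac{mst}{m(s-t)+st}\ <\ \min(t,m)$$ for every $V\in G(n,m)$.
   Context: $G(n,m)$ is the Grassmannian of $m$-dimensional linear subspaces of $\mathbb{R}^n$ and $\pi_V:\mathbb{R}^n\to V$ is orthogonal projection onto $V$. For non-empty bounded $E\subseteq\mathbb{R}^n$ and $r>0$, $N_r(E)$ is the minimum number of sets of diameter $r$ (using diameter at most $r$ gives the same dimensions) that can cover $E$. The upper box dimension is $\overline{\dim}_{\mathrm B}E=\limsup_{r\to0}\frac{\log N_r(E)}{-\log r}$. The packing dimension is $\dim_{\mathrm P}F=\inf\{\sup_j\overline{\dim}_{\mathrm B}F_j: F\subseteq\bigcup_{j=1}^\infty F_j,\ F_j\text{ compact}\}$. The Assouad dimension $\dim_{\mathrm A}F$ of a non-empty set $F$ is the infimum of $\alpha$ for which there is a constant $C>0$ such that $N_r(B(x,R)\cap F)\leq C(R/r)^\alpha$ for all $0<r<R$ and $x\in F$. For $\theta\in(0,1)$ the upper Assouad spectrum $\overline{\dim}_{\mathrm A}^{\theta}F$ is the infimum of $\alpha$ for which there is a constant $C>0$ such that $N_r(B(x,R)\cap F)\leq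 C(R/r)^\alpha$ for all $0<r\leq R^{1/\theta}<R<1$ and $x\in F$. The quasi-Assouad dimension is $\dim_{\mathrm{qA}}F=\lim_{\theta\nearrow1}\overline{\dim}_{\mathrm A}^{\theta}F$. *)

theory Defs
  imports "HOL-Analysis.Analysis"
begin

definition grassmannian :: "nat \<Rightarrow> ('a::euclidean_space) set set" where
  "grassmannian m = {V. subspace V \<and> dim V = m}"

definition orth_proj :: "('a::euclidean_space) set \<Rightarrow> 'a \<Rightarrow> 'a" where
  "orth_proj V x = (THE v. v \<in> V \<and> (\<forall>w\<in>V. orthogonal (x - v) w))"

(* "bounded U" is needed because the library's diameter is unspecified on unbounded sets.
   The minimum is only meaningful for bounded E and r > 0. *)
definition covering_number :: "real \<Rightarrow> ('a::euclidean_space) set \<Rightarrow> nat" where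
  "covering_number r E =
     (LEAST k. \<exists>\<U>. finite \<U> \<and> card \<U> = k \<and> E \<subseteq> \<Union>\<U> \<and>
        (\<forall>U\<in>\<U>. bounded U \<and> diameter U = r))"

(* For E = {} this evaluates to 0, since the covering number is 0 and ln 0 = 0. *)
definition upper_box_dim :: "('a::euclidean_space) set \<Rightarrow> ereal" where
  "upper_box_dim E =
     Limsup (at_right 0) (\<lambda>r. ereal (ln (real (covering_number r E)) / (- ln r)))"

(* Empty members of the cover contribute 0 to the supremum; this does not affect the value,
   because non-empty bounded sets have non-negative upper box dimension. *)
definition packing_dim :: "('a::euclidean_space) set \<Rightarrow> ereal" where
  "packing_dim F =
     Inf {(SUP j. upper_box_dim (G j)) | G :: nat \<Rightarrow> 'a set.
            (\<forall>j. compact (G j)) \<and> F \<subseteq> (\<Union>j. G j)}"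

definition assouad_dim :: "('a::euclidean_space) set \<Rightarrow> ereal" where
  "assouad_dim F =
     Inf {ereal \<alpha> | \<alpha>. \<exists>C>0. \<forall>r R. \<forall>x\<in>F. 0 < r \<and> r < R \<longrightarrow>
            real (covering_number r (cball x R \<inter> F)) \<le> C * (R / r) powr \<alpha>}"

definition upper_assouad_spectrum :: "real \<Rightarrow> ('a::euclidean_space) set \<Rightarrow> ereal" where
  "upper_assouad_spectrum \<theta> F =
     Inf {ereal \<alpha> | \<alpha>. \<exists>C>0. \<forall>r R. \<forall>x\<in>F.
            0 < r \<and> r \<le> R powr (1 / \<theta>) \<and> R powr (1 / \<theta>) < R \<and> R < 1 \<longrightarrow>
            real (covering_number r (cball x R \<inter> F)) \<le> C * (R / r) powr \<alpha>}"

(* The limit exists because the upper Assouad spectrum is non-decreasing in \<theta>. *)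
definition quasi_assouad_dim :: "('a::euclidean_space) set \<Rightarrow> ereal" where
  "quasi_assouad_dim F = Lim (at_left 1) (\<lambda>\<theta>. upper_assouad_spectrum \<theta> F)"

end

theory Submission
  imports Defs
begin

text \<open>The set is \<open>F = K\<^sup>n\<close> for a Cantor set \<open>K\<close> whose intervals are repeatedly split in two, so that
  \<open>F\<close> has \<open>2 powr (n j)\<close> cubes of generation \<open>j\<close>.  Between factorial generations the side length
  shrinks by the factor \<open>2 powr (- n / s)\<close> per step, so \<open>F\<close> looks \<open>s\<close>-dimensional there, which gives the
  Assouad dimension.  Just after a factorial it drops at once, by exactly as much as is needed for
  \<open>F\<close> to have upper box dimension \<open>t\<close> along the factorial generations.  Since this drop happens
  uniformly over \<open>F\<close>, every relatively open piece also has upper box dimension \<open>t\<close>, and Baire's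
  theorem gives the packing dimension.  At scales past such a drop, covering the projection of each
  surviving cube as if it were a full \<open>m\<close>-dimensional ball is cheaper than counting the smaller
  cubes as long as their number grows faster than \<open>m\<close>-dimensionally.  The two counts agree at the
  scale where the asserted bound is attained.\<close>

subsection \<open>Covering numbers and dimensions\<close>

text \<open>Closed balls of radius \<open>r / 2\<close> have diameter exactly \<open>r\<close>, as
  \<open>covering_number\<close> demands of the sets in a cover.\<close>

lemma covering_number_le:
  fixes E :: "'a::euclidean_space set"
  assumes "finite X" "0 \<le> r" "E \<subseteq> (\<Union>x\<in>X. cball x (r / 2))"
  shows "covering_number r E \<le> card X"
proof -
  have "covering_number r E \<le> card ((\<lambda>x. cball x (r / 2)) ` X)"
    unfolding covering_number_def using assms by (intro Least_le exI conjI refl) auto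
  also have "\<dots> \<le> card X"
    using assms(1) by (rule card_image_le)
  finally show ?thesis .
qed

text \<open>A set of diameter \<open>r\<close> contains at most one point of \<open>S\<close>, so
  assigning to each point a covering set around it is injective.\<close>

lemma covering_number_ge:
  fixes E :: "'a::euclidean_space set"
  assumes "bounded E" "0 < r" "S \<subseteq> E"
    and sep: "\<And>x y. x \<in> S \<Longrightarrow> y \<in> S \<Longrightarrow> x \<noteq> y \<Longrightarrow> r < dist x y"
  shows "card S \<le> covering_number r E"
proof -
  define P where "P = (\<lambda>k \<U>. finite \<U> \<and> card \<U> = k \<and> E \<subseteq> \<Union>\<U> \<and> (\<forall>U\<in>\<U>. bounded U \<and> diameter U = r))"
  \<comment> \<open>\<open>LEAST\<close> returns the size of an actual cover only once some finite
    cover exists; total boundedness of the closure supplies one.\<close>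
  have "seq_compact (closure E)"
    using assms(1) unfolding compact_eq_seq_compact_metric[symmetric] compact_closure .
  then obtain X where X: "finite X" "closure E \<subseteq> (\<Union>x\<in>X. ball x (r / 2))"
    using seq_compact_imp_totally_bounded[of "closure E"] \<open>0 < r\<close> by (metis half_gt_zero)
  have "E \<subseteq> (\<Union>x\<in>X. cball x (r / 2))"
    using X(2) closure_subset[of E] by (meson UN_mono ball_subset_cball order_refl subset_trans)
  then have "P (card ((\<lambda>x. cball x (r / 2)) ` X)) ((\<lambda>x. cball x (r / 2)) ` X)"
    unfolding P_def using X(1) \<open>0 < r\<close> by auto
  then have "\<exists>k \<U>. P k \<U>" by blast
  then have "\<exists>\<U>. P (covering_number r E) \<U>"
    unfolding covering_number_def P_def by (rule LeastI_ex)
  then obtain \<U> where U: "finite \<U>" "card \<U> = covering_number r E" "E \<subseteq> \<Union>\<U>"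
    "\<And>U. U \<in> \<U> \<Longrightarrow> bounded U \<and> diameter U = r"
    unfolding P_def by blast
  have "\<forall>x\<in>S. \<exists>U\<in>\<U>. x \<in> U"
    using U(3) assms(3) by blast
  then obtain f where f: "\<And>x. x \<in> S \<Longrightarrow> f x \<in> \<U> \<and> x \<in> f x"
    by metis
  have "inj_on f S"
  proof (rule inj_onI, rule ccontr)
    fix x y assume xy: "x \<in> S" "y \<in> S" "f x = f y" "x \<noteq> y"
    then have "dist x y \<le> diameter (f x)"
      using f U(4) by (metis diameter_bounded_bound)
    then show False
      using sep[of x y] xy f U(4) by fastforce
  qed
  then show ?thesis
    using card_inj_on_le[of f S \<U>] f U by auto
qed

text \<open>A constant factor does not affect the exponent: half of the slack goes to the
  hypothesis, the other half absorbs the logarithm of the constant for small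
  \<open>r\<close>.\<close>

lemma upper_box_dim_le:
  fixes E :: "'a::euclidean_space set"
  assumes "0 \<le> a"
    and *: "\<And>\<epsilon>. 0 < \<epsilon> \<Longrightarrow> \<exists>C. \<forall>\<^sub>F r in at_right 0. real (covering_number r E) \<le> C * r powr - (a + \<epsilon>)"
  shows "upper_box_dim E \<le> ereal a"
proof (rule ereal_le_epsilon2)
  fix e :: real assume "0 < e"
  then obtain C where C: "\<forall>\<^sub>F r in at_right 0. real (covering_number r E) \<le> C * r powr - (a + e / 2)"
    using *[of "e / 2"] by auto
  \<comment> \<open>Raising the constant to at least 1 makes \<open>ln C'\<close> non-negative,
    which covers the default \<open>ln 0 = 0\<close> when the covering number is 0.\<close>
  define C' where "C' = max C 1"
  have "LIM r at_right (0::real). - ln r :> at_top"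
    using ln_at_0 by (simp add: filterlim_uminus_at_bot[symmetric])
  then have "\<forall>\<^sub>F r in at_right 0. 2 * ln C' / e \<le> - ln r"
    by (simp add: filterlim_at_top)
  moreover have "\<forall>\<^sub>F r in at_right (0::real). r < 1"
    unfolding eventually_at_right[OF zero_less_one] by (intro exI[of _ 1]) auto
  moreover have "\<forall>\<^sub>F r in at_right (0::real). 0 < r"
    by (simp add: eventually_at_right_less)
  ultimately have "\<forall>\<^sub>F r in at_right 0. ereal (ln (real (covering_number r E)) / (- ln r)) \<le> ereal (a + e)"
    using C
  proof eventually_elim
    fix r :: real
    assume r: "2 * ln C' / e \<le> - ln r" "r < 1" "0 < r"
      and cov: "real (covering_number r E) \<le> C * r powr - (a + e / 2)"
    have "0 < - ln r" using r by simp
    have "C * r powr - (a + e / 2) \<le> C' * r powr - (a + e / 2)"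
      unfolding C'_def by (intro mult_right_mono) auto
    with cov have cov': "real (covering_number r E) \<le> C' * r powr - (a + e / 2)" by linarith
    have rhs: "ln (C' * r powr - (a + e / 2)) = ln C' + (a + e / 2) * (- ln r)"
      using r by (simp add: C'_def ln_mult ln_powr algebra_simps)
    have "ln (real (covering_number r E)) \<le> ln C' + (a + e / 2) * (- ln r)"
    proof (cases "covering_number r E = 0")
      case True
      have "0 \<le> ln C'" by (simp add: C'_def)
      moreover have "0 \<le> (a + e / 2) * (- ln r)"
        using \<open>0 < - ln r\<close> \<open>0 \<le> a\<close> \<open>0 < e\<close> by (intro mult_nonneg_nonneg) auto
      ultimately show ?thesis using True by simp
    next
      case False
      then show ?thesis using cov' rhs by (metis ln_mono of_nat_0_less_iff neq0_conv)
    qed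
    also have "ln C' \<le> e / 2 * (- ln r)"
      using r(1) \<open>0 < e\<close> by (simp add: field_simps)
    finally have "ln (real (covering_number r E)) \<le> (a + e) * (- ln r)"
      by (simp add: algebra_simps)
    then show "ereal (ln (real (covering_number r E)) / (- ln r)) \<le> ereal (a + e)"
      using \<open>0 < - ln r\<close> by (simp only: ereal_less_eq pos_divide_le_eq)
  qed
  then show "upper_box_dim E \<le> ereal a + ereal e"
    unfolding upper_box_dim_def by (simp add: Limsup_bounded)
qed

text \<open>For a limsup one sequence of scales suffices. If the dimension were below some
  \<open>y < a\<close>, the gap \<open>a - y\<close> would absorb the constant
  \<open>c\<close>.\<close>

lemma upper_box_dim_ge:
  fixes E :: "'a::euclidean_space set" and \<rho> :: "nat \<Rightarrow> real"
  assumes lim: "filterlim \<rho> (at_right 0) sequentially" and "0 < c"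
    and *: "\<forall>\<^sub>F k in sequentially. c * \<rho> k powr - a \<le> real (covering_number (\<rho> k) E)"
  shows "ereal a \<le> upper_box_dim E"
proof (rule ccontr)
  assume "\<not> ereal a \<le> upper_box_dim E"
  then have "upper_box_dim E < ereal a" by simp
  then obtain y where y: "upper_box_dim E < ereal y" "ereal y < ereal a"
    using ereal_dense2[of "upper_box_dim E" "ereal a"] by auto
  have "\<forall>\<^sub>F r in at_right 0. ereal (ln (real (covering_number r E)) / (- ln r)) < ereal y"
    using y(1) unfolding upper_box_dim_def by (rule Limsup_lessD)
  moreover have "\<forall>\<^sub>F r in at_right (0::real). r < 1"
    unfolding eventually_at_right[OF zero_less_one] by (intro exI[of _ 1]) auto
  moreover have "\<forall>\<^sub>F r in at_right (0::real). 0 < r"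
    by (simp add: eventually_at_right_less)
  moreover have "LIM r at_right (0::real). - ln r :> at_top"
    using ln_at_0 by (simp add: filterlim_uminus_at_bot[symmetric])
  then have "\<forall>\<^sub>F r in at_right 0. - ln c / (a - y) \<le> - ln r"
    unfolding filterlim_at_top by (rule spec)
  ultimately have "\<forall>\<^sub>F r in at_right 0. real (covering_number r E) < c * r powr - a"
  proof eventually_elim
    fix r :: real
    assume r: "r < 1" "0 < r" "- ln c / (a - y) \<le> - ln r"
      and less: "ereal (ln (real (covering_number r E)) / (- ln r)) < ereal y"
    have "0 < - ln r" using r by simp
    then have "ln (real (covering_number r E)) < y * (- ln r)"
      using less by (simp only: less_ereal.simps pos_divide_less_eq)
    also have "\<dots> \<le> ln c + a * (- ln r)"
      using r(3) y(2) by (simp add: field_simps)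
    also have "\<dots> = ln (c * r powr - a)"
      using r \<open>0 < c\<close> by (simp add: ln_mult ln_powr)
    finally show "real (covering_number r E) < c * r powr - a"
      using r \<open>0 < c\<close>
      by (cases "covering_number r E = 0") (auto simp: ln_less_cancel_iff)
  qed
  then have "\<forall>\<^sub>F k in sequentially. real (covering_number (\<rho> k) E) < c * \<rho> k powr - a"
    using lim by (rule eventually_compose_filterlim)
  with * have "\<forall>\<^sub>F k in sequentially. False"
    by eventually_elim simp
  then show False by simp
qed

lemma packing_dim_le_upper_box_dim:
  assumes "compact F"
  shows "packing_dim F \<le> upper_box_dim F"
proof -
  have "packing_dim F \<le> (SUP j::nat. upper_box_dim F)"
    unfolding packing_dim_def using assms
    by (intro Inf_lower CollectI exI[of _ "\<lambda>_. F"]) auto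
  then show ?thesis by simp
qed

text \<open>Baire category: the relatively open sets \<open>F - G j\<close> have empty intersection,
  so one of them is not dense in \<open>F\<close>. The corresponding \<open>G j\<close> contains a
  relatively open piece of \<open>F\<close>.\<close>

lemma packing_dim_ge:
  fixes F :: "'a::euclidean_space set"
  assumes "compact F" "F \<noteq> {}"
    and *: "\<And>G y e. compact G \<Longrightarrow> y \<in> F \<Longrightarrow> 0 < e \<Longrightarrow> F \<inter> ball y e \<subseteq> G \<Longrightarrow> a \<le> upper_box_dim G"
  shows "a \<le> packing_dim F"
  unfolding packing_dim_def
proof (rule Inf_greatest, safe)
  fix G :: "nat \<Rightarrow> 'a set"
  assume G: "\<forall>j. compact (G j)" "F \<subseteq> (\<Union>j. G j)"
  have "\<exists>j. \<not> F \<subseteq> closure (F - G j)"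
  proof (rule ccontr)
    assume dense: "\<nexists>j. \<not> F \<subseteq> closure (F - G j)"
    have "F \<subseteq> closure (\<Inter>(range (\<lambda>j. F - G j)))"
    proof (rule Baire)
      show "closed F" using assms(1) by (rule compact_imp_closed)
      fix T assume "T \<in> range (\<lambda>j. F - G j)"
      then obtain j where T: "T = F - G j" by blast
      have "openin (top_of_set F) T"
        unfolding T Diff_eq using G(1) by (intro openin_open_Int open_Compl compact_imp_closed) auto
      then show "openin (top_of_set F) T \<and> F \<subseteq> closure T"
        using dense T by blast
    qed auto
    moreover have "\<Inter>(range (\<lambda>j. F - G j)) = {}" using G(2) by auto
    ultimately show False using assms(2) by (metis closure_empty subset_empty)
  qed
  then obtain j y where y: "y \<in> F" "y \<notin> closure (F - G j)" by blast
  then obtain e where "0 < e" "\<forall>z\<in>F - G j. \<not> dist z y < e"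
    unfolding closure_approachable by blast
  then have "a \<le> upper_box_dim (G j)"
    using G(1) y(1) by (intro *[of _ y e]) (auto simp: dist_commute)
  then show "a \<le> (SUP j. upper_box_dim (G j))"
    by (rule SUP_upper2[OF UNIV_I])
qed

text \<open>For \<open>0 < R < 1\<close> the threshold \<open>R powr (1 / \<theta>)\<close> grows
  with \<theta>, so a larger \<theta> constrains more pairs of scales and admits fewer
  exponents.\<close>

lemma upper_assouad_spectrum_mono:
  assumes "0 < \<theta>" "\<theta> \<le> \<theta>'" "\<theta>' < 1"
  shows "upper_assouad_spectrum \<theta> F \<le> upper_assouad_spectrum \<theta>' F"
  unfolding upper_assouad_spectrum_def
proof (rule Inf_superset_mono, safe)
  fix \<alpha> C :: real
  assume "0 < C" and C: "\<forall>r R. \<forall>x\<in>F. 0 < r \<and> r \<le> R powr (1 / \<theta>') \<and> R powr (1 / \<theta>') < R \<and> R < 1 \<longrightarrow>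
     real (covering_number r (cball x R \<inter> F)) \<le> C * (R / r) powr \<alpha>"
  have "real (covering_number r (cball x R \<inter> F)) \<le> C * (R / r) powr \<alpha>"
    if "x \<in> F" "0 < r" "r \<le> R powr (1 / \<theta>)" "R powr (1 / \<theta>) < R" "R < 1" for r R x
  proof -
    have "0 < R" using that by linarith
    have "R powr (1 / \<theta>) \<le> R powr (1 / \<theta>')"
      using \<open>0 < R\<close> that assms by (intro powr_mono') (auto simp: field_simps)
    moreover have "R powr (1 / \<theta>') < R powr 1"
      using \<open>0 < R\<close> that assms by (intro powr_less_mono') (auto simp: field_simps)
    ultimately show ?thesis using C that \<open>0 < R\<close> by auto
  qed
  then show "\<exists>\<alpha>'. ereal \<alpha> = ereal \<alpha>' \<and> (\<exists>C>0. \<forall>r R. \<forall>x\<in>F. 0 < r \<and> r \<le> R powr (1 / \<theta>) \<and> R powr (1 / \<theta>) < R \<and> R < 1 \<longrightarrow>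
     real (covering_number r (cball x R \<inter> F)) \<le> C * (R / r) powr \<alpha>')"
    using \<open>0 < C\<close> by blast
qed

lemma upper_assouad_spectrum_le_assouad_dim: "upper_assouad_spectrum \<theta> F \<le> assouad_dim F"
  unfolding upper_assouad_spectrum_def assouad_dim_def
proof (rule Inf_superset_mono, safe)
  fix \<alpha> C :: real
  assume "0 < C" and C: "\<forall>r R. \<forall>x\<in>F. 0 < r \<and> r < R \<longrightarrow>
     real (covering_number r (cball x R \<inter> F)) \<le> C * (R / r) powr \<alpha>"
  then show "\<exists>\<alpha>'. ereal \<alpha> = ereal \<alpha>' \<and> (\<exists>C>0. \<forall>r R. \<forall>x\<in>F. 0 < r \<and> r \<le> R powr (1 / \<theta>) \<and> R powr (1 / \<theta>) < R \<and> R < 1 \<longrightarrow>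
     real (covering_number r (cball x R \<inter> F)) \<le> C * (R / r) powr \<alpha>')"
    by (intro exI[of _ \<alpha>] exI[of _ C]) auto
qed

lemma quasi_assouad_dim_le_assouad_dim: "quasi_assouad_dim F \<le> assouad_dim F"
proof -
  \<comment> \<open>By monotonicity the left limit at 1 exists and is this supremum; convergence is
    what gives \<open>Lim\<close> its meaning.\<close>
  define L where "L = (SUP \<theta>\<in>{0<..<1}. upper_assouad_spectrum \<theta> F)"
  have "((\<lambda>\<theta>. upper_assouad_spectrum \<theta> F) \<longlongrightarrow> L) (at_left 1)"
  proof (rule increasing_tendsto)
    show "\<forall>\<^sub>F \<theta> in at_left 1. upper_assouad_spectrum \<theta> F \<le> L"
      unfolding L_def eventually_at_left[OF zero_less_one]
      by (intro exI[of _ 0]) (auto intro!: SUP_upper)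
    fix y assume "y < L"
    then obtain \<theta> where \<theta>: "0 < \<theta>" "\<theta> < 1" "y < upper_assouad_spectrum \<theta> F"
      unfolding L_def less_SUP_iff by auto
    have "y < upper_assouad_spectrum \<theta>' F" if "\<theta> < \<theta>'" "\<theta>' < 1" for \<theta>'
      using \<theta> that upper_assouad_spectrum_mono[of \<theta> \<theta>' F] by (meson less_imp_le less_le_trans)
    then show "\<forall>\<^sub>F \<theta> in at_left 1. y < upper_assouad_spectrum \<theta> F"
      unfolding eventually_at_left[OF zero_less_one] using \<theta> by blast
  qed
  then have "quasi_assouad_dim F = L"
    unfolding quasi_assouad_dim_def by (intro tendsto_Lim) auto
  also have "L \<le> assouad_dim F"
    unfolding L_def by (intro SUP_least upper_assouad_spectrum_le_assouad_dim)
  finally show ?thesis .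
qed

subsection \<open>Orthogonal projections\<close>

lemma orth_proj_unique:
  assumes "subspace V" "v \<in> V" "\<And>w. w \<in> V \<Longrightarrow> orthogonal (x - v) w"
  shows "orth_proj V x = v"
  unfolding orth_proj_def
proof (rule the_equality)
  fix v' assume v': "v' \<in> V \<and> (\<forall>w\<in>V. orthogonal (x - v') w)"
  have "v - v' \<in> V" using assms v' by (simp add: subspace_diff)
  then have "(x - v') \<bullet> (v - v') = 0" "(x - v) \<bullet> (v - v') = 0"
    using assms(3) v' by (auto simp: orthogonal_def)
  then have "(v - v') \<bullet> (v - v') = 0"
    by (simp add: inner_diff_left)
  then show "v' = v" by simp
qed (use assms in auto)

lemma orth_proj:
  assumes "subspace V"
  shows "orth_proj V x \<in> V" "\<And>w. w \<in> V \<Longrightarrow> (x - orth_proj V x) \<bullet> w = 0"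
proof -
  obtain v z where v: "v \<in> span V" "\<And>w. w \<in> span V \<Longrightarrow> orthogonal z w" "x = v + z"
    using orthogonal_subspace_decomp_exists[of V x] by metis
  have "orth_proj V x = v"
    using v assms by (intro orth_proj_unique) (auto simp: span_eq_iff[THEN iffD2])
  then show "orth_proj V x \<in> V" "\<And>w. w \<in> V \<Longrightarrow> (x - orth_proj V x) \<bullet> w = 0"
    using v assms by (auto simp: span_eq_iff[THEN iffD2] orthogonal_def)
qed

text \<open>The difference of the two projections lies in \<open>V\<close>, hence is orthogonal to
  both residuals. Its squared norm is therefore its inner product with \<open>x - y\<close>, and
  Cauchy-Schwarz applies.\<close>

lemma dist_orth_proj_le:
  assumes "subspace V"
  shows "dist (orth_proj V x) (orth_proj V y) \<le> dist x y"
proof -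
  let ?p = "orth_proj V x - orth_proj V y"
  have "?p \<in> V"
    using orth_proj(1)[OF assms] assms by (simp add: subspace_diff)
  then have "(x - orth_proj V x) \<bullet> ?p - (y - orth_proj V y) \<bullet> ?p = 0"
    using orth_proj(2)[OF assms] by simp
  then have "norm ?p * norm ?p = (x - y) \<bullet> ?p"
    by (simp add: inner_diff_left power2_norm_eq_inner[symmetric] power2_eq_square[symmetric] del: inner_diff_right)
      (simp add: power2_norm_eq_inner inner_diff_left)
  also have "\<dots> \<le> norm (x - y) * norm ?p"
    by (rule norm_cauchy_schwarz)
  finally show ?thesis
    unfolding dist_norm by (cases "norm ?p = 0") auto
qed

lemma compact_orth_proj_image:
  assumes "subspace V" "compact F"
  shows "compact (orth_proj V ` F)"
proof (rule compact_continuous_image)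
  have "1-lipschitz_on F (orth_proj V)"
    using dist_orth_proj_le[OF assms(1)] by (intro lipschitz_onI) auto
  then show "continuous_on F (orth_proj V)" by (rule lipschitz_on_continuous_on)
qed (rule assms)

text \<open>A grid in an orthonormal basis: rounding down each of the \<open>m\<close> coordinates
  costs at most \<open>r / (2 * m)\<close>, in total \<open>r / 2\<close>. As \<open>R / r\<close>
  is at least 1, it absorbs the additive 2 in the number of grid values per axis.\<close>

lemma subspace_cball_cover:
  fixes V :: "'a::euclidean_space set"
  assumes "subspace V" "dim V = m" "c \<in> V" "0 < r" "r \<le> R"
  shows "\<exists>X. finite X \<and> real (card X) \<le> ((4 * real m + 2) * (R / r)) ^ m \<and>
    V \<inter> cball c R \<subseteq> (\<Union>x\<in>X. cball x (r / 2))"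
proof -
  obtain B where B: "B \<subseteq> V" "pairwise orthogonal B" "\<And>x. x \<in> B \<Longrightarrow> norm x = 1"
    "independent B" "card B = dim V" "span B = V"
    using orthonormal_basis_subspace[OF assms(1)] by metis
  have "finite B" using B(4) by (rule independent_imp_finite)
  show ?thesis
  proof (cases "m = 0")
    \<comment> \<open>The mesh used below divides by \<open>m\<close>; here \<open>V\<close> is
      \<open>{0}\<close> and one ball suffices.\<close>
    case True
    then have "V = {0}" using assms by (simp add: dim_eq_0) (metis subspace_0 subset_singletonD empty_iff)
    then show ?thesis using True assms by (intro exI[of _ "{0}"]) auto
  next
    case False
    define \<delta> where "\<delta> = r / (2 * real m)"
    have "0 < \<delta>" using False assms by (simp add: \<delta>_def)
    define I where "I = {\<lfloor>- R / \<delta>\<rfloor>..\<lfloor>R / \<delta>\<rfloor>}"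
    define X where "X = (\<lambda>k. c + (\<Sum>b\<in>B. (of_int (k b) * \<delta>) *\<^sub>R b)) ` (B \<rightarrow>\<^sub>E I)"
    have "finite X" unfolding X_def I_def using \<open>finite B\<close> by (intro finite_imageI finite_PiE) auto
    have "real (card X) \<le> real (card (B \<rightarrow>\<^sub>E I))"
      unfolding X_def using \<open>finite B\<close> by (intro of_nat_mono card_image_le finite_PiE) (auto simp: I_def)
    also have "\<dots> = real (card I) ^ m"
      using B(5) assms(2) \<open>finite B\<close> by (simp add: card_PiE)
    also have "\<dots> \<le> ((4 * real m + 2) * (R / r)) ^ m"
    proof (rule power_mono)
      have "- R / \<delta> \<le> R / \<delta>" using assms \<open>0 < \<delta>\<close> by (simp add: field_simps)
      then have "real (card I) = of_int (\<lfloor>R / \<delta>\<rfloor> - \<lfloor>- R / \<delta>\<rfloor> + 1)"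
        unfolding I_def by (simp add: floor_mono)
      also have "\<dots> \<le> R / \<delta> + R / \<delta> + 2"
        by simp linarith
      also have "\<dots> = 4 * real m * (R / r) + 2 * 1"
        using False assms by (simp add: \<delta>_def)
      also have "\<dots> \<le> (4 * real m + 2) * (R / r)"
        using assms unfolding distrib_right by (intro add_left_mono mult_left_mono) auto
      finally show "real (card I) \<le> (4 * real m + 2) * (R / r)" .
    qed simp
    finally have card: "real (card X) \<le> ((4 * real m + 2) * (R / r)) ^ m" .
    have "V \<inter> cball c R \<subseteq> (\<Union>x\<in>X. cball x (r / 2))"
    proof safe
      fix y assume y: "y \<in> V" "y \<in> cball c R"
      define k where "k = restrict (\<lambda>b. \<lfloor>(y - c) \<bullet> b / \<delta>\<rfloor>) B"
      have "k \<in> B \<rightarrow>\<^sub>E I"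
      proof (rule PiE_I)
        fix b assume b: "b \<in> B"
        have "\<bar>(y - c) \<bullet> b\<bar> \<le> norm (y - c) * norm b" by (rule Cauchy_Schwarz_ineq2)
        also have "\<dots> \<le> R" using y b B(3) by (simp add: dist_norm norm_minus_commute)
        finally have "- R / \<delta> \<le> (y - c) \<bullet> b / \<delta>" "(y - c) \<bullet> b / \<delta> \<le> R / \<delta>"
          using \<open>0 < \<delta>\<close> divide_right_mono[of "- R" "(y - c) \<bullet> b" \<delta>] divide_right_mono[of "(y - c) \<bullet> b" R \<delta>]
          unfolding abs_le_iff by linarith+
        then show "k b \<in> I" unfolding k_def I_def using b by (auto intro!: floor_mono)
      qed (simp add: k_def)
      have "y - c \<in> span B" using y assms B(6) by (simp add: subspace_diff)
      then have "(\<Sum>b\<in>B. ((y - c) \<bullet> b) *\<^sub>R b) = y - c"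
        using B \<open>finite B\<close> by (intro orthonormal_basis_expand) auto
      then have "y - (c + (\<Sum>b\<in>B. (of_int (k b) * \<delta>) *\<^sub>R b))
          = (\<Sum>b\<in>B. ((y - c) \<bullet> b) *\<^sub>R b) - (\<Sum>b\<in>B. (of_int (k b) * \<delta>) *\<^sub>R b)"
        by simp
      also have "\<dots> = (\<Sum>b\<in>B. ((y - c) \<bullet> b - of_int (k b) * \<delta>) *\<^sub>R b)"
        by (simp add: sum_subtractf scaleR_left_diff_distrib)
      also have "norm \<dots> \<le> (\<Sum>b\<in>B. \<delta>)"
      proof (rule sum_norm_le)
        fix b assume b: "b \<in> B"
        have "of_int (k b) \<le> (y - c) \<bullet> b / \<delta>" "(y - c) \<bullet> b / \<delta> \<le> of_int (k b) + 1"
          using b by (auto simp: k_def)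
        then have "of_int (k b) * \<delta> \<le> (y - c) \<bullet> b" "(y - c) \<bullet> b \<le> of_int (k b) * \<delta> + \<delta>"
          using \<open>0 < \<delta>\<close> by (auto simp: field_simps)
        then show "norm (((y - c) \<bullet> b - of_int (k b) * \<delta>) *\<^sub>R b) \<le> \<delta>"
          using B(3)[OF b] by simp
      qed
      also have "\<dots> = r / 2"
        using False B(5) assms(2) by (simp add: \<delta>_def)
      finally have "y \<in> cball (c + (\<Sum>b\<in>B. (of_int (k b) * \<delta>) *\<^sub>R b)) (r / 2)"
        by (simp add: dist_norm norm_minus_commute)
      then show "y \<in> (\<Union>x\<in>X. cball x (r / 2))"
        using \<open>k \<in> B \<rightarrow>\<^sub>E I\<close> unfolding X_def by blast
    qed
    then show ?thesis using \<open>finite X\<close> card by blast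
  qed
qed

text \<open>Projection does not increase distances, so each ball lands in a ball of the same radius
  inside \<open>V\<close>, where covering it costs only an \<open>m\<close>-th power.\<close>

lemma covering_number_orth_proj_le:
  fixes E V :: "'a::euclidean_space set"
  assumes "subspace V" "dim V = m" "finite X" "E \<subseteq> (\<Union>x\<in>X. cball x R)" "0 < r" "r \<le> R"
  shows "real (covering_number r (orth_proj V ` E)) \<le> real (card X) * ((4 * real m + 2) * (R / r)) ^ m"
proof -
  define b where "b = ((4 * real m + 2) * (R / r)) ^ m"
  obtain Y where Y: "\<And>x. finite (Y x)" "\<And>x. real (card (Y x)) \<le> b"
    "\<And>x. V \<inter> cball (orth_proj V x) R \<subseteq> (\<Union>y\<in>Y x. cball y (r / 2))"
    using subspace_cball_cover[OF assms(1,2) orth_proj(1)[OF assms(1)] assms(5,6)]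
    unfolding b_def by metis
  have "covering_number r (orth_proj V ` E) \<le> card (\<Union>x\<in>X. Y x)"
  proof (rule covering_number_le)
    show "orth_proj V ` E \<subseteq> (\<Union>y\<in>(\<Union>x\<in>X. Y x). cball y (r / 2))"
    proof safe
      fix e assume "e \<in> E"
      then obtain x where x: "x \<in> X" "dist x e \<le> R" using assms(4) by auto
      then have "orth_proj V e \<in> V \<inter> cball (orth_proj V x) R"
        using orth_proj(1)[OF assms(1)] dist_orth_proj_le[OF assms(1), of x e] by simp
      then show "orth_proj V e \<in> (\<Union>y\<in>(\<Union>x\<in>X. Y x). cball y (r / 2))"
        using Y(3)[of x] x by blast
    qed
  qed (use assms Y in auto)
  also have "\<dots> \<le> (\<Sum>x\<in>X. card (Y x))"
    using assms(3) by (rule card_UN_le)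
  finally have "real (covering_number r (orth_proj V ` E)) \<le> (\<Sum>x\<in>X. real (card (Y x)))"
    by (metis of_nat_mono of_nat_sum)
  also have "\<dots> \<le> (\<Sum>x\<in>X. b)" by (intro sum_mono Y)
  finally show ?thesis by (simp add: b_def)
qed

subsection \<open>Products of Cantor sets\<close>

lemma card_vec_box: "card {x::'a^'n. \<forall>i. x $ i \<in> S i} = (\<Prod>i\<in>UNIV. card (S i))"
proof -
  have "bij_betw vec_nth {x::'a^'n. \<forall>i. x $ i \<in> S i} (PiE UNIV S)"
    by (rule bij_betwI[where g = vec_lambda]) (auto simp: fun_eq_iff)
  then show ?thesis by (simp add: bij_betw_same_card card_PiE)
qed

lemma finite_vec_box:
  assumes "\<And>i. finite (S i)"
  shows "finite {x::'a^'n. \<forall>i. x $ i \<in> S i}"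
proof -
  have "bij_betw vec_nth {x::'a^'n. \<forall>i. x $ i \<in> S i} (PiE UNIV S)"
    by (rule bij_betwI[where g = vec_lambda]) (auto simp: fun_eq_iff)
  then show ?thesis using assms by (simp add: bij_betw_finite finite_PiE)
qed

lemma norm_le_card_mult:
  fixes x :: "real^'n"
  assumes "\<And>i. \<bar>x $ i\<bar> \<le> b"
  shows "norm x \<le> real CARD('n) * b"
proof -
  have "norm x \<le> (\<Sum>i\<in>UNIV. \<bar>x $ i\<bar>)" by (rule norm_le_l1_cart)
  also have "\<dots> \<le> (\<Sum>i\<in>(UNIV::'n set). b)" by (intro sum_mono assms)
  finally show ?thesis by simp
qed

text \<open>Rounding down \<open>(x - a) / \<delta>\<close> is injective on \<open>S\<close>, with
  values 0, 1, 2 and, at the right endpoint, 3.\<close>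

lemma separated_subset_of_interval:
  fixes S :: "real set"
  assumes "0 < \<delta>" "S \<subseteq> {a..a + 3 * \<delta>}" "\<And>x y. x \<in> S \<Longrightarrow> y \<in> S \<Longrightarrow> x \<noteq> y \<Longrightarrow> \<delta> \<le> \<bar>x - y\<bar>"
  shows "finite S" "card S \<le> 4"
proof -
  define f where "f = (\<lambda>x. \<lfloor>(x - a) / \<delta>\<rfloor>)"
  have inj: "inj_on f S"
  proof (rule inj_onI, rule ccontr)
    fix x y assume xy: "x \<in> S" "y \<in> S" "f x = f y" "x \<noteq> y"
    have "\<bar>(x - a) / \<delta> - (y - a) / \<delta>\<bar> < 1"
      using xy(3) unfolding f_def by linarith
    moreover have "(x - a) / \<delta> - (y - a) / \<delta> = (x - y) / \<delta>"
      by (simp add: diff_divide_distrib)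
    ultimately have "\<bar>x - y\<bar> < \<delta>" using assms(1) by simp
    then show False using assms(3)[of x y] xy by simp
  qed
  have sub: "f ` S \<subseteq> {0..3}"
  proof safe
    fix x assume "x \<in> S"
    then have "0 \<le> (x - a) / \<delta>" "(x - a) / \<delta> \<le> 3"
      using assms(1,2) by (auto simp: field_simps)
    then show "f x \<in> {0..3}" unfolding f_def using floor_mono[of "(x - a) / \<delta>" 3] by simp
  qed
  show "finite S" using inj sub by (meson finite_atLeastAtMost_int inj_on_finite)
  show "card S \<le> 4" using card_inj_on_le[OF inj sub] by simp
qed

text \<open>The inequality leaves room for two children at the two ends of an interval. Equality is
  allowed: children touch between the jumps when \<open>s\<close> equals the ambient
  dimension.\<close>

locale cantor_lengths =
  fixes l :: "nat \<Rightarrow> real"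
  assumes l_pos: "0 < l k" and l_Suc_le: "2 * l (Suc k) \<le> l k"
begin

lemma l_antimono: "i \<le> j \<Longrightarrow> l j \<le> l i"
  by (rule lift_Suc_antimono_le) (use l_pos l_Suc_le in \<open>smt (verit)\<close>)

lemma l_tendsto_0: "l \<longlonglongrightarrow> 0"
proof (rule tendsto_sandwich[of "\<lambda>_. 0" _ _ "\<lambda>k. l 0 * (1 / 2) ^ k"])
  have "l k \<le> l 0 * (1 / 2) ^ k" for k
  proof (induction k)
    case (Suc k)
    have "l (Suc k) \<le> l k / 2" using l_Suc_le[of k] by simp
    also have "\<dots> \<le> l 0 * (1 / 2) ^ k / 2" using Suc by (intro divide_right_mono) auto
    finally show ?case by simp
  qed simp
  then show "\<forall>\<^sub>F k in sequentially. l k \<le> l 0 * (1 / 2) ^ k" by simp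
  show "(\<lambda>k. l 0 * (1 / 2) ^ k) \<longlonglongrightarrow> 0"
    by (intro tendsto_mult_right_zero LIMSEQ_realpow_zero) auto
qed (simp_all add: l_pos less_imp_le)

lemma ex_l_le: "0 < r \<Longrightarrow> \<exists>q. l (i + q) \<le> r"
  using order_tendstoD(2)[OF l_tendsto_0, of r]
  by (metis eventually_sequentially le_add2 less_imp_le)

text \<open>Left endpoints, relative to that of a given interval of generation \<open>i\<close>, of the intervals
  of generation \<open>i + q\<close> inside it.\<close>

primrec ends :: "nat \<Rightarrow> nat \<Rightarrow> real set" where
  "ends i 0 = {0}"
| "ends i (Suc q) = ends i q \<union> (\<lambda>e. e + (l (i + q) - l (Suc (i + q)))) ` ends i q"

lemma ends_bounds: "e \<in> ends i q \<Longrightarrow> 0 \<le> e \<and> e + l (i + q) \<le> l i"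
proof (induction q arbitrary: e)
  case (Suc q)
  then show ?case
    using l_Suc_le[of "i + q"] l_pos[of "Suc (i + q)"] by fastforce
qed simp

lemma zero_in_ends: "0 \<in> ends i q"
  by (induction q) auto

lemma finite_ends: "finite (ends i q)"
  by (induction q) auto

text \<open>Only an unshifted and a shifted endpoint need care. With the same parent they are a full
  shift apart, at least the new length; with different parents the shift leaves at least the new
  length of the old distance.\<close>

lemma ends_separated:
  "e \<in> ends i q \<Longrightarrow> e' \<in> ends i q \<Longrightarrow> e \<noteq> e' \<Longrightarrow> l (i + q) \<le> \<bar>e - e'\<bar>"
proof (induction q arbitrary: e e')
  case (Suc q)
  have half: "2 * l (Suc (i + q)) \<le> l (i + q)" "0 < l (Suc (i + q))"
    by (rule l_Suc_le, rule l_pos)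
  have shift: "l (Suc (i + q)) \<le> \<bar>a - (b + (l (i + q) - l (Suc (i + q))))\<bar>"
    if "a \<in> ends i q" "b \<in> ends i q" for a b
    using Suc.IH[OF that] half by (cases "a = b") (auto simp: abs_if split: if_splits)
  have same: "l (Suc (i + q)) \<le> \<bar>a - b\<bar>" if "a \<in> ends i q" "b \<in> ends i q" "a \<noteq> b" for a b
    using Suc.IH[OF that] half by linarith
  from Suc.prems show ?case
    using shift same by (auto simp: abs_minus_commute)
qed simp

lemma card_ends: "card (ends i q) = 2 ^ q"
proof (induction q)
  case (Suc q)
  let ?d = "l (i + q) - l (Suc (i + q))"
  have "0 < ?d" "?d < l (i + q)"
    using l_Suc_le[of "i + q"] l_pos[of "Suc (i + q)"] by linarith+
  then have "ends i q \<inter> (\<lambda>e. e + ?d) ` ends i q = {}"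
    using ends_separated[of _ i q] by fastforce
  moreover have "card ((\<lambda>e. e + ?d) ` ends i q) = card (ends i q)"
    by (intro card_image) (simp add: inj_on_def)
  ultimately show ?case
    using Suc finite_ends[of i q] by (simp add: card_Un_disjoint)
qed simp

text \<open>All intervals of a generation split alike, so one set of offsets serves them all; this
  localizes the counts.\<close>

lemma ends_add: "ends 0 (i + q) = {p + e | p e. p \<in> ends 0 i \<and> e \<in> ends i q}"
  by (induction q) (fastforce simp: image_iff)+

definition cantor :: "real set" where
  "cantor = {x. \<forall>j. \<exists>p\<in>ends 0 j. p \<le> x \<and> x \<le> p + l j}"

text \<open>A left endpoint stays one in all later generations and lies in its ancestor's interval
  in all earlier ones.\<close>

lemma ends_subset_cantor: "ends 0 j \<subseteq> cantor"
  unfolding cantor_def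
proof (safe)
  fix p k assume p: "p \<in> ends 0 j"
  show "\<exists>q\<in>ends 0 k. q \<le> p \<and> p \<le> q + l k"
  proof (cases "j \<le> k")
    case True
    have "p \<in> ends 0 k"
      using p ends_add[of j "k - j"] zero_in_ends[of j "k - j"] True by force
    then show ?thesis using l_pos[of k] by force
  next
    case False
    then obtain q e where qe: "p = q + e" "q \<in> ends 0 k" "e \<in> ends k (j - k)"
      using p ends_add[of k "j - k"] by auto
    then show ?thesis
      using ends_bounds[OF qe(3)] l_pos[of "k + (j - k)"] by (intro bexI[of _ q]) linarith+
  qed
qed

lemma zero_in_cantor: "0 \<in> cantor"
  using ends_subset_cantor[of 0] by simp

lemma compact_cantor: "compact cantor"
proof -
  have eq: "cantor = (\<Inter>j. \<Union>p\<in>ends 0 j. {p..p + l j})"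
    unfolding cantor_def by auto
  have "closed cantor"
    unfolding eq by (intro closed_INT closed_UN ballI finite_ends closed_atLeastAtMost)
  moreover have "cantor \<subseteq> {0..l 0}"
    unfolding cantor_def by (auto dest: spec[of _ 0])
  ultimately show ?thesis
    by (metis bounded_closed_interval bounded_subset compact_eq_bounded_closed)
qed

lemma cantor_cover:
  assumes "R \<le> l i \<or> i = 0"
  shows "\<exists>Q. finite Q \<and> card Q \<le> 4 * 2 ^ q \<and>
    (\<forall>y\<in>cantor. \<bar>x - y\<bar> \<le> R \<longrightarrow> (\<exists>p\<in>Q. p \<le> y \<and> y \<le> p + l (i + q)))"
proof -
  \<comment> \<open>An interval of length \<open>l i\<close> that meets the
    \<open>R\<close>-neighbourhood of \<open>x\<close>, with \<open>R \<le> l i\<close>, has its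
    left endpoint in this window of length \<open>3 * l i\<close>. Generation 0 has a single
    interval, so \<open>R\<close> is then arbitrary.\<close>
  define P where "P = (if i = 0 then {0} else ends 0 i \<inter> {x - 2 * l i..x + l i})"
  have P: "finite P \<and> card P \<le> 4"
  proof (cases "i = 0")
    case False
    have "P \<subseteq> {x - 2 * l i..(x - 2 * l i) + 3 * l i}"
      "\<And>a b. a \<in> P \<Longrightarrow> b \<in> P \<Longrightarrow> a \<noteq> b \<Longrightarrow> l i \<le> \<bar>a - b\<bar>"
      using False ends_separated[of _ 0 i] by (auto simp: P_def)
    then show ?thesis
      using separated_subset_of_interval[OF l_pos] by blast
  qed (simp add: P_def)
  define Q where "Q = (\<lambda>(p, e). p + e) ` (P \<times> ends i q)"
  have "finite Q" unfolding Q_def using P finite_ends by blast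
  moreover have "card Q \<le> 4 * 2 ^ q"
  proof -
    have "card Q \<le> card (P \<times> ends i q)"
      unfolding Q_def using P finite_ends by (intro card_image_le) blast
    also have "\<dots> \<le> 4 * 2 ^ q"
      using P by (simp add: card_cartesian_product card_ends)
    finally show ?thesis .
  qed
  moreover have "\<exists>p\<in>Q. p \<le> y \<and> y \<le> p + l (i + q)" if y: "y \<in> cantor" "\<bar>x - y\<bar> \<le> R" for y
  proof -
    obtain q' where q': "q' \<in> ends 0 (i + q)" "q' \<le> y" "y \<le> q' + l (i + q)"
      using y(1) unfolding cantor_def by blast
    then obtain p e where pe: "q' = p + e" "p \<in> ends 0 i" "e \<in> ends i q"
      using ends_add by auto
    have "p \<in> P"
      using ends_bounds[OF pe(3)] pe q' y(2) assms l_pos[of i] by (auto simp: P_def abs_le_iff)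
    then have "q' \<in> Q" using pe by (auto simp: Q_def)
    then show ?thesis using q' by blast
  qed
  ultimately show ?thesis by blast
qed

text \<open>The witnesses are all endpoints of generation \<open>i + q\<close> inside one interval
  of generation \<open>i\<close> around \<open>y\<close>.\<close>

lemma cantor_separated:
  assumes "y \<in> cantor"
  shows "\<exists>S\<subseteq>cantor. finite S \<and> card S = 2 ^ q \<and> (\<forall>x\<in>S. \<bar>y - x\<bar> \<le> l i) \<and>
    (\<forall>a\<in>S. \<forall>b\<in>S. a \<noteq> b \<longrightarrow> l (i + q) \<le> \<bar>a - b\<bar>)"
proof -
  obtain p where p: "p \<in> ends 0 i" "p \<le> y" "y \<le> p + l i"
    using assms unfolding cantor_def by blast
  define S where "S = (\<lambda>e. p + e) ` ends i q"
  have "S \<subseteq> ends 0 (i + q)" using p by (auto simp: S_def ends_add)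
  then have "S \<subseteq> cantor" using ends_subset_cantor by blast
  moreover have "finite S" "card S = 2 ^ q"
    by (simp_all add: S_def finite_ends card_image card_ends)
  moreover have "\<forall>x\<in>S. \<bar>y - x\<bar> \<le> l i"
    using p ends_bounds[of _ i q] l_pos[of "i + q"] by (fastforce simp: S_def)
  moreover have "\<forall>a\<in>S. \<forall>b\<in>S. a \<noteq> b \<longrightarrow> l (i + q) \<le> \<bar>a - b\<bar>"
    using ends_separated[of _ i q] by (auto simp: S_def)
  ultimately show ?thesis by blast
qed

section \<open>Finite powers of the Cantor set\<close>

definition dust :: "(real^'n) set" where
  "dust = {x. \<forall>i. x $ i \<in> cantor}"

lemma zero_in_dust: "0 \<in> dust"
  by (simp add: dust_def zero_in_cantor)

lemma compact_dust: "compact (dust :: (real^'n) set)"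
proof -
  have "closed (dust :: (real^'n) set)"
    unfolding dust_def
    by (intro closed_Collect_all closed_vimage[of cantor, unfolded vimage_def] continuous_intros
        compact_imp_closed compact_cantor)
  moreover obtain b where b: "\<And>x. x \<in> cantor \<Longrightarrow> \<bar>x\<bar> \<le> b"
    using compact_imp_bounded[OF compact_cantor] unfolding bounded_iff by auto
  have "bounded (dust :: (real^'n) set)"
    unfolding bounded_iff dust_def
    by (intro exI[of _ "real CARD('n) * b"] ballI norm_le_card_mult) (auto intro: b)
  ultimately show ?thesis by (simp add: compact_eq_bounded_closed)
qed

text \<open>Covers of the coordinates multiply; the factor \<open>CARD('n)\<close> in the radius
  comes from estimating the norm by the sum of the coordinates.\<close>

lemma dust_cover:
  fixes x :: "real^'n"
  assumes "R \<le> l i \<or> i = 0"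
  shows "\<exists>X. finite X \<and> card X \<le> (4 * 2 ^ q) ^ CARD('n) \<and>
    cball x R \<inter> dust \<subseteq> (\<Union>p\<in>X. cball p (real CARD('n) * l (i + q)))"
proof -
  have "\<forall>k. \<exists>Q. finite Q \<and> card Q \<le> 4 * 2 ^ q \<and>
    (\<forall>y\<in>cantor. \<bar>x $ k - y\<bar> \<le> R \<longrightarrow> (\<exists>p\<in>Q. p \<le> y \<and> y \<le> p + l (i + q)))"
    by (intro allI cantor_cover assms)
  from choice[OF this] obtain Q where Q: "\<And>k. finite (Q k)" "\<And>k. card (Q k) \<le> 4 * 2 ^ q"
    "\<And>k y. y \<in> cantor \<Longrightarrow> \<bar>x $ k - y\<bar> \<le> R \<Longrightarrow> (\<exists>p\<in>Q k. p \<le> y \<and> y \<le> p + l (i + q))"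
    by blast
  define X where "X = {p::real^'n. \<forall>k. p $ k \<in> Q k}"
  have "card X \<le> (\<Prod>k\<in>(UNIV::'n set). 4 * 2 ^ q)"
    unfolding X_def card_vec_box by (intro prod_mono) (simp add: Q)
  then have "card X \<le> (4 * 2 ^ q) ^ CARD('n)" by simp
  moreover have "finite X" unfolding X_def by (intro finite_vec_box Q)
  moreover have "cball x R \<inter> dust \<subseteq> (\<Union>p\<in>X. cball p (real CARD('n) * l (i + q)))"
  proof safe
    fix y assume y: "y \<in> cball x R" "y \<in> dust"
    have "\<bar>x $ k - y $ k\<bar> \<le> R" for k
      using y(1) component_le_norm_cart[of "x - y" k] by (simp add: dist_norm)
    then have "\<forall>k. \<exists>p\<in>Q k. p \<le> y $ k \<and> y $ k \<le> p + l (i + q)"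
      using y(2) Q(3) by (simp add: dust_def)
    then obtain p where p: "\<And>k. p k \<in> Q k \<and> p k \<le> y $ k \<and> y $ k \<le> p k + l (i + q)"
      by metis
    have "norm (vec_lambda p - y) \<le> real CARD('n) * l (i + q)"
    proof (rule norm_le_card_mult)
      show "\<bar>(vec_lambda p - y) $ k\<bar> \<le> l (i + q)" for k
        using p[of k] l_pos[of "i + q"] by simp
    qed
    then have "y \<in> cball (vec_lambda p) (real CARD('n) * l (i + q))" by (simp add: dist_norm)
    moreover have "vec_lambda p \<in> X" using p by (simp add: X_def)
    ultimately show "y \<in> (\<Union>p\<in>X. cball p (real CARD('n) * l (i + q)))" by blast
  qed
  ultimately show ?thesis by blast
qed

lemma covering_number_dust_le:
  fixes x :: "real^'n"
  assumes "R \<le> l i \<or> i = 0" "2 * real CARD('n) * l (i + q) \<le> r"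
  shows "covering_number r (cball x R \<inter> dust) \<le> (4 * 2 ^ q) ^ CARD('n)"
proof -
  obtain X where X: "finite X" "card X \<le> (4 * 2 ^ q) ^ CARD('n)"
    "cball x R \<inter> dust \<subseteq> (\<Union>p\<in>X. cball p (real CARD('n) * l (i + q)))"
    using dust_cover[OF assms(1)] by metis
  have "cball p (real CARD('n) * l (i + q)) \<subseteq> cball p (r / 2)" for p :: "real^'n"
    using assms(2) by (intro subset_cball) simp
  with X(3) have "cball x R \<inter> dust \<subseteq> (\<Union>p\<in>X. cball p (r / 2))" by blast
  moreover have "0 \<le> real CARD('n) * l (i + q)"
    using l_pos[of "i + q"] by simp
  then have "0 \<le> r" using assms(2) by linarith
  ultimately have "covering_number r (cball x R \<inter> dust) \<le> card X"
    using X(1) by (intro covering_number_le)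
  with X(2) show ?thesis by linarith
qed

text \<open>Distinct points of a product of separated sets are \<open>l (i + q)\<close> apart in
  some coordinate. A general bounded \<open>G\<close> serves both the compact sets of the packing
  dimension and the balls of the Assouad dimension.\<close>

lemma covering_number_dust_ge:
  fixes y :: "real^'n"
  assumes "y \<in> dust" "real CARD('n) * l i \<le> R" "0 < r" "r < l (i + q)"
    and "bounded G" "cball y R \<inter> dust \<subseteq> G"
  shows "(2 ^ q) ^ CARD('n) \<le> covering_number r G"
proof -
  have "\<forall>k. \<exists>S\<subseteq>cantor. finite S \<and> card S = 2 ^ q \<and> (\<forall>x\<in>S. \<bar>y $ k - x\<bar> \<le> l i) \<and>
    (\<forall>a\<in>S. \<forall>b\<in>S. a \<noteq> b \<longrightarrow> l (i + q) \<le> \<bar>a - b\<bar>)"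
    using assms(1) by (intro allI cantor_separated) (simp add: dust_def)
  then obtain S where S: "\<And>k. S k \<subseteq> cantor" "\<And>k. card (S k) = 2 ^ q"
    "\<And>k x. x \<in> S k \<Longrightarrow> \<bar>y $ k - x\<bar> \<le> l i"
    "\<And>k a b. a \<in> S k \<Longrightarrow> b \<in> S k \<Longrightarrow> a \<noteq> b \<Longrightarrow> l (i + q) \<le> \<bar>a - b\<bar>"
    by metis
  define X where "X = {p::real^'n. \<forall>k. p $ k \<in> S k}"
  have "card X = (2 ^ q) ^ CARD('n)"
    unfolding X_def card_vec_box by (simp add: S)
  moreover have "card X \<le> covering_number r G"
  proof (rule covering_number_ge)
    have "X \<subseteq> cball y R \<inter> dust"
    proof safe
      fix p assume p: "p \<in> X"
      then show "p \<in> dust" using S(1) by (auto simp: X_def dust_def)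
      have "norm (y - p) \<le> real CARD('n) * l i"
        by (rule norm_le_card_mult) (use p S(3) in \<open>simp add: X_def\<close>)
      then show "p \<in> cball y R" using assms(2) by (simp add: dist_norm)
    qed
    then show "X \<subseteq> G" using assms(6) by blast
    fix a b assume ab: "a \<in> X" "b \<in> X" "a \<noteq> b"
    then obtain k where "a $ k \<noteq> b $ k" by (auto simp: vec_eq_iff)
    then have "l (i + q) \<le> \<bar>(a - b) $ k\<bar>" using ab S(4)[of "a $ k" k "b $ k"] by (simp add: X_def)
    also have "\<dots> \<le> dist a b" unfolding dist_norm by (rule component_le_norm_cart)
    finally show "r < dist a b" using assms(4) by simp
  qed (use assms in auto)
  ultimately show ?thesis by simp
qed

end

subsection \<open>Side lengths dropping at the factorials\<close>

lemma of_nat_le_power: "a \<le> (4 * 2 ^ q) ^ N \<Longrightarrow> real a \<le> (4 * 2 ^ q) ^ N"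
  using of_nat_mono[of a "(4 * 2 ^ q) ^ N", where 'a = real] by simp

lemma power_power_eq_powr: "(2 ^ q) ^ N = (2 :: real) powr (real N * real q)"
proof -
  have "(2 :: real) powr (real (N * q)) = 2 ^ (N * q)" by (rule powr_realpow) simp
  also have "\<dots> = (2 ^ q) ^ N" by (simp only: power_mult[symmetric] mult.commute)
  finally show ?thesis by simp
qed

definition next_fact :: "nat \<Rightarrow> nat" where
  "next_fact j = fact (LEAST k. j \<le> fact k)"

lemma le_next_fact: "j \<le> next_fact j"
  unfolding next_fact_def by (rule LeastI_ex) (blast intro: fact_ge_self)

lemma next_fact_le: "j \<le> fact k \<Longrightarrow> next_fact j \<le> fact k"
  unfolding next_fact_def by (intro fact_mono_nat Least_le)

lemma next_fact_mono: "i \<le> j \<Longrightarrow> next_fact i \<le> next_fact j"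
  by (metis le_next_fact next_fact_def next_fact_le order_trans)

lemma next_fact_fact: "next_fact (fact k) = fact k"
  by (intro antisym le_next_fact next_fact_le) simp

lemma next_fact_eq:
  assumes "fact k < j" "j \<le> fact (Suc k)"
  shows "next_fact j = fact (Suc k)"
proof -
  have "(LEAST k. j \<le> fact k) = Suc k"
  proof (rule Least_equality)
    fix y assume "j \<le> fact y"
    then have "\<not> fact y \<le> (fact k :: nat)" using assms(1) by linarith
    then show "Suc k \<le> y" using fact_mono_nat[of y k] by linarith
  qed (use assms in simp)
  then show ?thesis by (simp add: next_fact_def)
qed

locale fact_blocks =
  fixes N :: nat and s t :: real
  assumes t_pos: "0 < t" and t_less_s: "t < s" and s_le_N: "s \<le> real N"
begin

text \<open>Chosen so that \<open>c * j + j / s = j / t\<close>.\<close>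

definition c :: real where "c = 1 / t - 1 / s"

text \<open>\<open>2 powr (- N * lev j)\<close> is the side length at which there are \<open>2 ^ (N * j)\<close> cubes.  So \<open>lev\<close>
  has slope \<open>1 / s\<close> except at the factorials, where it jumps so far that \<open>lev j = j / t\<close> at the
  next factorial; in between \<open>lev j \<ge> j / t\<close>.\<close>

definition lev :: "nat \<Rightarrow> real" where
  "lev j = c * real (next_fact j) + real j / s"

definition len :: "nat \<Rightarrow> real" where
  "len j = 2 powr (- (real N * lev j))"

lemma s_pos: "0 < s" and N_pos: "0 < real N" and c_pos: "0 < c"
  using t_pos t_less_s s_le_N by (auto simp: c_def field_simps)

lemma lev_ge: "real j / t \<le> lev j"
proof -
  have "real j / t = c * real j + real j / s" by (simp add: c_def field_simps)
  also have "\<dots> \<le> lev j"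
    unfolding lev_def using c_pos le_next_fact[of j] by (intro add_right_mono mult_left_mono) auto
  finally show ?thesis .
qed

lemma lev_fact: "lev (fact k) = fact k / t"
  by (simp add: lev_def next_fact_fact c_def field_simps)

lemma lev_increase: "lev i + real q / s \<le> lev (i + q)"
  using mult_left_mono[OF of_nat_mono[OF next_fact_mono[of i "i + q"]], of c] c_pos
  by (simp add: lev_def add_divide_distrib)

lemma len_decrease: "len (i + q) \<le> len i * 2 powr (- (real N * real q / s))"
proof -
  have "real N * (lev i + real q / s) \<le> real N * lev (i + q)"
    by (intro mult_left_mono lev_increase) simp
  then have "len (i + q) \<le> 2 powr (- (real N * lev i) + - (real N * real q / s))"
    unfolding len_def by (intro powr_mono) (auto simp: distrib_left)
  then show ?thesis unfolding len_def powr_add .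
qed

text \<open>The bound \<open>s \<le> real N\<close> makes each step shrink by a factor of at most
  1/2.\<close>

sublocale cantor_lengths len
proof
  show "0 < len k" for k by (simp add: len_def)
  show "2 * len (Suc k) \<le> len k" for k
  proof -
    have "1 \<le> real N * real 1 / s" using s_le_N s_pos by simp
    then have "2 powr (- (real N * real 1 / s)) \<le> 2 powr (- 1)"
      by (intro powr_mono) auto
    then have "len k * 2 powr (- (real N * real 1 / s)) \<le> len k * (1 / 2)"
      by (intro mult_left_mono) (auto simp: len_def powr_minus)
    then show ?thesis using len_decrease[of k 1] by simp
  qed
qed

section \<open>Box dimension of the dust, globally and locally\<close>

lemma len_powr: "len j powr - t = 2 powr (real N * lev j * t)"
  by (simp add: len_def powr_powr)

lemma dust_subset_cball: "\<exists>R. (dust :: (real^'n) set) \<subseteq> cball 0 R"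
  using bounded_subset_ballD[OF compact_imp_bounded[OF compact_dust]] ball_subset_cball by blast

lemma upper_box_dim_dust_le:
  assumes "CARD('n::finite) = N"
  shows "upper_box_dim (dust :: (real^'n) set) \<le> ereal t"
proof (rule upper_box_dim_le)
  fix \<epsilon> :: real assume "0 < \<epsilon>"
  define C where "C = 8 ^ N * (2 * real N) powr t"
  have bound: "real (covering_number r (dust :: (real^'n) set)) \<le> C * r powr - (t + \<epsilon>)"
    if r: "0 < r" "r < min 1 (2 * real N * len 0)" for r
  proof -
    have "\<exists>q. len (0 + q) \<le> r / (2 * real N)"
      using r N_pos by (intro ex_l_le) simp
    then have ex: "\<exists>q. 2 * real N * len q \<le> r"
      using N_pos by (auto simp: field_simps)
    \<comment> \<open>The first generation with small enough cubes. The bound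
      \<open>r < 2 * real N * len 0\<close> rules out \<open>q = 0\<close>, and the preceding
      generation \<open>p\<close> bounds \<open>r\<close> from above.\<close>
    define q where "q = (LEAST q. 2 * real N * len q \<le> r)"
    have q: "2 * real N * len q \<le> r" unfolding q_def using ex by (rule LeastI_ex)
    then have "q \<noteq> 0" using r by (auto intro: ccontr)
    then obtain p where p: "q = Suc p" by (cases q) auto
    then have "r < 2 * real N * len p"
      using not_less_Least[of p "\<lambda>q. 2 * real N * len q \<le> r"] unfolding q_def by auto
    then have "r / (2 * real N) \<le> len p" using N_pos by (simp add: field_simps)
    obtain R where R: "(dust :: (real^'n) set) \<subseteq> cball 0 R" using dust_subset_cball by blast
    then have "cball 0 R \<inter> dust = (dust :: (real^'n) set)" by blast
    then have "covering_number r (dust :: (real^'n) set) \<le> (4 * 2 ^ q) ^ N"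
      using covering_number_dust_le[where 'n = 'n and x = 0 and R = R and i = 0 and q = q and r = r] q assms
      by simp
    then have "real (covering_number r (dust :: (real^'n) set)) \<le> (4 * 2 ^ q) ^ N"
      by (rule of_nat_le_power)
    also have "\<dots> = 8 ^ N * 2 powr (real N * (real p / t) * t)"
    proof -
      have "4 * 2 ^ q = (8 :: real) * 2 ^ p" by (simp add: p)
      then show ?thesis using t_pos by (simp only: power_mult_distrib power_power_eq_powr) simp
    qed
    also have "\<dots> \<le> 8 ^ N * len p powr - t"
      unfolding len_powr using t_pos lev_ge[of p]
      by (intro mult_left_mono powr_mono mult_right_mono) auto
    also have "\<dots> \<le> 8 ^ N * (r / (2 * real N)) powr - t"
      using \<open>r / (2 * real N) \<le> len p\<close> r t_pos N_pos by (intro mult_left_mono powr_mono2') auto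
    also have "\<dots> = C * r powr - t"
      by (simp add: C_def powr_divide powr_minus_divide)
    also have "\<dots> \<le> C * r powr - (t + \<epsilon>)"
      using r \<open>0 < \<epsilon>\<close> by (intro mult_left_mono powr_mono') (auto simp: C_def)
    finally show ?thesis .
  qed
  have "0 < min 1 (2 * real N * len 0)" using N_pos l_pos by simp
  then show "\<exists>C. \<forall>\<^sub>F r in at_right 0. real (covering_number r (dust :: (real^'n) set)) \<le> C * r powr - (t + \<epsilon>)"
    using bound unfolding eventually_at_right[OF \<open>0 < min 1 (2 * real N * len 0)\<close>] by blast
qed (use t_pos in simp)

lemma upper_box_dim_ge_of_dust:
  fixes y :: "real^'n"
  assumes card: "CARD('n) = N" and "bounded G" "y \<in> dust" "0 < e" "dust \<inter> ball y e \<subseteq> G"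
  shows "ereal t \<le> upper_box_dim G"
proof -
  obtain i where "len (0 + i) \<le> e / (2 * real N)"
    using ex_l_le[of "e / (2 * real N)" 0] N_pos \<open>0 < e\<close> by auto
  then have i: "real N * len i \<le> e / 2" using N_pos by (simp add: field_simps)
  \<comment> \<open>At factorial generations the number of cubes is exactly
    \<open>len (fact k) powr - t\<close>. Halving the side length puts the scale strictly below
    their separation.\<close>
  define \<rho> where "\<rho> k = len (fact k) / 2" for k
  \<comment> \<open>Starting from one cube of generation \<open>i\<close> loses the factor
    \<open>2 powr (real N * real i)\<close>, and halving the scale loses
    \<open>2 powr t\<close>.\<close>
  define C where "C = 2 powr - (real N * real i + t)"
  show ?thesis
  proof (rule upper_box_dim_ge)
    have "filterlim (fact :: nat \<Rightarrow> nat) at_top sequentially"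
      by (rule filterlim_at_top_mono[OF filterlim_ident]) (simp add: fact_ge_self)
    then have "(\<lambda>k. len (fact k)) \<longlonglongrightarrow> 0"
      by (rule filterlim_compose[OF l_tendsto_0])
    then have "\<rho> \<longlonglongrightarrow> 0" unfolding \<rho>_def by (rule tendsto_divide_zero)
    then show "filterlim \<rho> (at_right 0) sequentially"
      by (rule tendsto_imp_filterlim_at_right) (simp add: \<rho>_def l_pos)
    show "0 < C" by (simp add: C_def)
    show "\<forall>\<^sub>F k in sequentially. C * \<rho> k powr - t \<le> real (covering_number (\<rho> k) G)"
      using eventually_ge_at_top[of i]
    proof eventually_elim
      fix k assume "i \<le> k"
      then have "i \<le> fact k" using fact_ge_self[of k] by linarith
      define q where "q = fact k - i"
      have q: "i + q = fact k" using \<open>i \<le> fact k\<close> by (simp add: q_def)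
      have "\<rho> k powr - t = 2 powr t * len (fact k) powr - t"
        by (simp add: \<rho>_def powr_divide powr_minus_divide)
      also have "len (fact k) powr - t = 2 powr (real N * real (i + q))"
        using t_pos by (simp add: len_powr lev_fact q)
      finally have "C * \<rho> k powr - t = 2 powr (real N * real q)"
        by (simp add: C_def distrib_left flip: powr_add)
      also have "\<dots> = real ((2 ^ q) ^ N)"
        by (simp add: power_power_eq_powr)
      also have "\<dots> \<le> real (covering_number (\<rho> k) G)"
      proof (rule of_nat_mono)
        show "(2 ^ q) ^ N \<le> covering_number (\<rho> k) G"
          unfolding card[symmetric]
        proof (rule covering_number_dust_ge[where y = y and i = i and R = "e / 2"])
          show "\<rho> k < len (i + q)" using l_pos[of "fact k"] by (simp add: q \<rho>_def)
          show "cball y (e / 2) \<inter> dust \<subseteq> G" using assms(4,5) by auto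
        qed (use assms i l_pos in \<open>auto simp: \<rho>_def\<close>)
      qed
      finally show "C * \<rho> k powr - t \<le> real (covering_number (\<rho> k) G)" .
    qed
  qed
qed

section \<open>Assouad dimension of the dust\<close>

lemma assouad_dim_dust_le:
  assumes card: "CARD('n::finite) = N"
  shows "assouad_dim (dust :: (real^'n) set) \<le> ereal s"
  unfolding assouad_dim_def
proof (intro Inf_lower CollectI exI conjI refl allI ballI impI)
  show "0 < 16 ^ N * (2 * real N) powr s" using N_pos by simp
  fix r R :: real and x :: "real^'n"
  assume "0 < r \<and> r < R"
  then have r: "0 < r" "r < R" by auto
  obtain i0 where "len (0 + i0) \<le> R" using ex_l_le[of R 0] r by auto
  then have exi: "len (Suc i0) \<le> R" using l_antimono[of i0 "Suc i0"] by simp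
  \<comment> \<open>This brackets \<open>R\<close>: the cover needs \<open>R \<le> len i\<close> or
    \<open>i = 0\<close>, and the ratio \<open>R / r\<close> is estimated through
    \<open>len (Suc i) \<le> R\<close>.\<close>
  define i where "i = (LEAST i. len (Suc i) \<le> R)"
  have i: "len (Suc i) \<le> R" unfolding i_def using exi by (rule LeastI)
  have "R \<le> len i \<or> i = 0"
  proof (cases i)
    case (Suc p)
    then show ?thesis
      using not_less_Least[of p "\<lambda>i. len (Suc i) \<le> R"] unfolding i_def by auto
  qed simp
  have "\<exists>q. len (i + q) \<le> r / (2 * real N)"
    using r N_pos by (intro ex_l_le) simp
  then have exq: "\<exists>q. 2 * real N * len (i + q) \<le> r"
    using N_pos by (auto simp: field_simps)
  define q where "q = (LEAST q. 2 * real N * len (i + q) \<le> r)"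
  have q: "2 * real N * len (i + q) \<le> r" unfolding q_def using exq by (rule LeastI_ex)
  have "1 \<le> R / r" "1 \<le> 2 * real N" using r N_pos by (auto simp: less_Suc_eq)
  then have "1 * 1 \<le> (2 * real N) * (R / r)" by (intro mult_mono) auto
  \<comment> \<open>Two generations are lost, one between \<open>len i\<close> and
    \<open>len (Suc i)\<close> and one from the minimality of \<open>q\<close>; they turn the
    constant 4 into 16.\<close>
  have main: "2 powr (real N * (real q - 2)) \<le> (2 * real N * (R / r)) powr s"
  proof (cases "q < 2")
    case True
    then have "2 powr (real N * (real q - 2)) \<le> 2 powr 0"
      by (intro powr_mono) (auto simp: mult_nonneg_nonpos)
    also have "\<dots> \<le> (2 * real N * (R / r)) powr s"
      using \<open>1 * 1 \<le> (2 * real N) * (R / r)\<close> s_pos by (simp add: ge_one_powr_ge_zero)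
    finally show ?thesis .
  next
    case False
    then obtain p where p: "q = Suc (Suc p)" by (metis add_2_eq_Suc le_Suc_ex not_less)
    then have "r < 2 * real N * len (Suc i + p)"
      using not_less_Least[of "Suc p" "\<lambda>q. 2 * real N * len (i + q) \<le> r"] unfolding q_def by auto
    \<comment> \<open>Jumps only shorten the cubes further, so the lengths decay everywhere at least
      as fast as between jumps.\<close>
    also have "\<dots> \<le> 2 * real N * (R * 2 powr (- (real N * real p / s)))"
      using i by (intro mult_left_mono order_trans[OF len_decrease[of "Suc i" p]] mult_right_mono) auto
    finally have "2 powr (real N * real p / s) \<le> 2 * real N * (R / r)"
      using r by (simp add: powr_minus field_simps)
    then have "(2 powr (real N * real p / s)) powr s \<le> (2 * real N * (R / r)) powr s"
      using s_pos by (intro powr_mono2) auto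
    then show ?thesis using s_pos by (simp add: p powr_powr)
  qed
  have "covering_number r (cball x R \<inter> dust) \<le> (4 * 2 ^ q) ^ N"
    using covering_number_dust_le[OF \<open>R \<le> len i \<or> i = 0\<close>, of q r x] q unfolding card by simp
  then have "real (covering_number r (cball x R \<inter> dust)) \<le> (4 * 2 ^ q) ^ N"
    by (rule of_nat_le_power)
  also have "\<dots> = 16 ^ N * 2 powr (real N * (real q - 2))"
  proof -
    have "(4 * 2 ^ q :: real) = 16 * 2 powr (real q - 2)"
      by (simp add: powr_diff powr_realpow)
    then show ?thesis by (simp add: power_mult_distrib powr_power)
  qed
  also have "\<dots> \<le> 16 ^ N * (2 * real N * (R / r)) powr s"
    using main by simp
  also have "\<dots> = 16 ^ N * (2 * real N) powr s * (R / r) powr s"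
    by (simp only: powr_mult mult.assoc)
  finally show "real (covering_number r (cball x R \<inter> dust)) \<le> 16 ^ N * (2 * real N) powr s * (R / r) powr s" .
qed simp

text \<open>No jump occurs here: it happens in the step from \<open>fact k\<close> to
  \<open>fact k + 1\<close>, hence the strict inequality.\<close>

lemma len_in_block:
  assumes "fact k < i" "i + q \<le> fact (Suc k)"
  shows "len (i + q) = len i * 2 powr (- (real N * real q / s))"
proof -
  have "next_fact i = fact (Suc k)" "next_fact (i + q) = fact (Suc k)"
    by (rule next_fact_eq; use assms in linarith)+
  then have "lev (i + q) = lev i + real q / s" by (simp add: lev_def add_divide_distrib)
  then show ?thesis by (simp add: len_def distrib_left flip: powr_add)
qed

lemma assouad_dim_dust_ge:
  assumes card: "CARD('n::finite) = N"
  shows "ereal s \<le> assouad_dim (dust :: (real^'n) set)"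
  unfolding assouad_dim_def
proof (rule Inf_greatest, safe)
  fix \<alpha> C :: real
  assume C: "0 < C" and *: "\<forall>r R. \<forall>x\<in>(dust :: (real^'n) set). 0 < r \<and> r < R \<longrightarrow>
     real (covering_number r (cball x R \<inter> dust)) \<le> C * (R / r) powr \<alpha>"
  \<comment> \<open>In a block of \<open>q\<close> steps, \<open>2 ^ (N * q)\<close> separated
    points face a ratio of scales of order \<open>2 powr (N * q / s)\<close>. For \<alpha> below
    \<open>s\<close> this would bound the block lengths, which grow without limit.\<close>
  have bound: "2 powr (real N * (1 - \<alpha> / s) * (fact (Suc k) - fact k - 1)) \<le> C * (2 * real N) powr \<alpha>" if "1 \<le> k" for k
  proof -
    define i q where "i = fact k + (1 :: nat)" and "q = fact (Suc k) - i"
    have "2 * fact k \<le> (fact (Suc k) :: nat)" using that by simp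
    moreover have "1 \<le> (fact k :: nat)" by (rule fact_ge_1)
    ultimately have iq: "i + q = fact (Suc k)" by (simp add: i_def q_def)
    have "real (i + q) = fact (Suc k)" unfolding iq by (rule of_nat_fact)
    then have rq: "real q = fact (Suc k) - fact k - 1" by (simp add: i_def del: fact_Suc)
    define r where "r = len (i + q) / 2"
    have len_eq: "len (i + q) = len i * 2 powr (- (real N * real q / s))"
      by (rule len_in_block[of k]) (auto simp: iq, simp add: i_def)
    have "0 < r" "r < len (i + q)" using l_pos[of "i + q"] by (auto simp: r_def)
    have "1 * len i \<le> real N * len i"
      using l_pos[of i] N_pos by (intro mult_right_mono) auto
    then have "len (i + q) \<le> real N * len i"
      using l_antimono[of i "i + q"] by simp
    then have "r < real N * len i" using \<open>r < len (i + q)\<close> by linarith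
    have "2 powr (real N * real q) = real ((2 ^ q) ^ N)"
      by (simp add: power_power_eq_powr)
    also have "\<dots> \<le> real (covering_number r (cball (0 :: real^'n) (real N * len i) \<inter> dust))"
      unfolding card[symmetric] using \<open>0 < r\<close> \<open>r < len (i + q)\<close>
      by (intro of_nat_mono covering_number_dust_ge[where y = 0 and i = i])
        (auto simp: zero_in_dust card)
    also have "\<dots> \<le> C * (real N * len i / r) powr \<alpha>"
      using * \<open>0 < r\<close> \<open>r < real N * len i\<close> zero_in_dust by blast
    also have "real N * len i / r = 2 * real N * 2 powr (real N * real q / s)"
      using l_pos[of i] by (simp add: r_def len_eq powr_minus field_simps)
    also have "\<dots> powr \<alpha> = (2 * real N) powr \<alpha> * 2 powr (real N * real q / s * \<alpha>)"
      by (simp add: powr_mult powr_powr)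
    finally have "2 powr (real N * real q) / 2 powr (real N * real q / s * \<alpha>) \<le> C * (2 * real N) powr \<alpha>"
      by (simp add: field_simps)
    moreover have "real N * real q - real N * real q / s * \<alpha> = real N * (1 - \<alpha> / s) * real q"
      by (simp add: algebra_simps)
    ultimately show ?thesis by (simp add: rq flip: powr_diff)
  qed
  show "ereal s \<le> ereal \<alpha>"
  proof (rule ccontr)
    assume "\<not> ereal s \<le> ereal \<alpha>"
    then have "0 < 1 - \<alpha> / s" using s_pos by simp
    then have pos: "0 < real N * (1 - \<alpha> / s)" using N_pos by simp
    define B where "B = C * (2 * real N) powr \<alpha>"
    have "0 < B" using C N_pos by (simp add: B_def)
    obtain k0 where k0: "log 2 B / (real N * (1 - \<alpha> / s)) < real k0" using reals_Archimedean2 by blast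
    define k where "k = Suc k0"
    have "real k0 \<le> fact (Suc k) - fact k - 1"
    proof -
      have "k0 + 1 \<le> k * 1" by (simp add: k_def)
      also have "\<dots> \<le> k * fact k" by (intro mult_left_mono) (auto simp: fact_ge_1)
      finally have "real (k0 + 1) \<le> real (k * fact k)" by (rule of_nat_mono)
      then show ?thesis by (simp add: distrib_right)
    qed
    then have "log 2 B / (real N * (1 - \<alpha> / s)) < fact (Suc k) - fact k - 1" using k0 by linarith
    then have "log 2 B < real N * (1 - \<alpha> / s) * (fact (Suc k) - fact k - 1)"
      using pos by (metis mult.commute pos_divide_less_eq)
    then have "B < 2 powr (real N * (1 - \<alpha> / s) * (fact (Suc k) - fact k - 1))"
      using \<open>0 < B\<close> by (simp add: log_less_iff)
    then show False using bound[of k] by (simp add: B_def k_def)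
  qed
qed

section \<open>Box dimension of the projections\<close>

text \<open>\<open>real j + m * max 0 (u - lev j)\<close> is the exponent in the bound for the projection at scale
  \<open>2 powr (- N * u)\<close> obtained from covering each cube of generation \<open>j\<close> separately.  The first
  generation after a jump is the right one to use.\<close>

lemma ex_good_generation:
  assumes "0 \<le> m" "0 < D" and D: "m = D * (m * c + 1)" and "0 < \<epsilon>"
  shows "\<exists>U. \<forall>u\<ge>U. \<exists>j. real j + m * max 0 (u - lev j) \<le> (D + \<epsilon>) * u + 1"
proof -
  \<comment> \<open>For \<open>k \<ge> K\<close> this makes \<open>fact k\<close> less than
    \<epsilon> times \<open>c * fact (Suc k)\<close>.\<close>
  obtain K where K: "1 / (c * \<epsilon>) < real K" using reals_Archimedean2 by blast
  have "0 < c * \<epsilon>" using c_pos assms by simp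
  then have "0 < 1 / (c * \<epsilon>)" by simp
  then have "1 \<le> K" using K by (cases K) auto
  have "\<exists>j. real j + m * max 0 (u - lev j) \<le> (D + \<epsilon>) * u + 1" if u: "fact K / D \<le> u" for u
  proof -
    have "fact K \<le> D * u" using u assms by (simp add: field_simps)
    have "0 < fact K / D" using assms by simp
    then have "0 < u" using u by linarith
    obtain k0 where "D * u < real k0" using reals_Archimedean2 by blast
    also have "real k0 \<le> fact (Suc k0)"
      using fact_ge_self[of "Suc k0"] by (metis Suc_leD of_nat_fact of_nat_le_iff)
    finally have ex: "\<exists>k. D * u < fact (Suc k)" by blast
    \<comment> \<open>The scale is located by \<open>fact k \<le> D * u < fact (Suc k)\<close>;
      \<open>j\<close> below is the first generation after the jump at
      \<open>fact k\<close>.\<close>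
    define k where "k = (LEAST k. D * u < fact (Suc k))"
    have k: "D * u < fact (Suc k)" unfolding k_def using ex by (rule LeastI_ex)
    have "K \<le> k"
    proof (rule ccontr)
      assume "\<not> K \<le> k"
      then have "fact (Suc k) \<le> (fact K :: real)" by (intro fact_mono) auto
      then show False using k \<open>fact K \<le> D * u\<close> by linarith
    qed
    then obtain p where p: "k = Suc p" using \<open>1 \<le> K\<close> by (cases k) auto
    then have Dk: "fact k \<le> D * u"
      using not_less_Least[of p "\<lambda>k. D * u < fact (Suc k)"] unfolding k_def by auto
    define j where "j = fact k + (1 :: nat)"
    have "next_fact j = fact (Suc k)"
    proof (rule next_fact_eq)
      have "1 \<le> p * fact p + fact p" using fact_ge_1[of p, where 'a = nat] by linarith
      then show "j \<le> fact (Suc k)" by (simp add: j_def p)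
    qed (simp add: j_def)
    then have lev: "c * fact (Suc k) \<le> lev j" using s_pos by (simp add: lev_def del: fact_Suc)
    have "real j + m * max 0 (u - lev j) \<le> (D + \<epsilon>) * u + 1"
    proof (cases "u \<le> lev j")
      case True
      then have "real j + m * max 0 (u - lev j) \<le> D * u + 1"
        using Dk by (simp add: j_def)
      moreover have "0 \<le> \<epsilon> * u" using assms \<open>0 < u\<close> by simp
      ultimately show ?thesis by (simp add: distrib_right)
    next
      case False
      \<comment> \<open>The cubes exceed the scale. Covering one projected cube contributes at most
        \<open>D * u\<close> to the exponent, and the number of cubes only
        \<open>\<epsilon> * u + 1\<close>.\<close>
      have "c * fact (Suc k) < u" using lev False by linarith
      have "m * (u - lev j) \<le> m * (u - c * fact (Suc k))"
        using lev assms by (intro mult_left_mono) auto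
      \<comment> \<open>As \<open>D\<close> is \<open>m / (m * c + 1)\<close>, covering by full
        balls breaks even with \<open>D * u\<close> exactly at
        \<open>D * u = fact (Suc k)\<close>.\<close>
      also have "\<dots> - D * u = m * c * (D * u - fact (Suc k))"
      proof -
        have "m * u = D * (m * c + 1) * u" using D by simp
        then show ?thesis by (simp add: algebra_simps)
      qed
      then have "m * (u - c * fact (Suc k)) \<le> D * u"
        using k assms c_pos mult_nonneg_nonpos[of "m * c" "D * u - fact (Suc k)"] by simp
      finally have 1: "m * (u - lev j) \<le> D * u" .
      have "1 < c * \<epsilon> * real K" using K \<open>0 < c * \<epsilon>\<close> by (simp add: field_simps)
      also have "\<dots> \<le> c * \<epsilon> * (real k + 1)"
        using \<open>0 < c * \<epsilon>\<close> \<open>K \<le> k\<close> by (intro mult_left_mono) auto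
      finally have "u * 1 \<le> u * (c * \<epsilon> * (real k + 1))"
        using \<open>0 < u\<close> by (intro mult_left_mono) auto
      then have "c * (real k + 1) * fact k \<le> c * (real k + 1) * (\<epsilon> * u)"
        using \<open>c * fact (Suc k) < u\<close> by (simp add: algebra_simps)
      then have "fact k \<le> \<epsilon> * u" using c_pos by (simp add: mult_le_cancel_left_pos)
      with 1 False show ?thesis by (simp add: j_def distrib_right max_def)
    qed
    then show ?thesis ..
  qed
  then show ?thesis by blast
qed

text \<open>The equation for \<open>D\<close> says \<open>D = m / (m * c + 1)\<close>, which becomes
  the asserted bound on substituting \<open>c\<close>. Each scale uses its own generation from
  \<open>ex_good_generation\<close>.\<close>

lemma upper_box_dim_proj_dust_le:
  fixes V :: "(real^'n) set"
  assumes card: "CARD('n) = N" and V: "subspace V" "dim V = m"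
    and "0 < D" and D: "real m = D * (real m * c + 1)"
  shows "upper_box_dim (orth_proj V ` dust) \<le> ereal D"
proof (rule upper_box_dim_le)
  fix \<epsilon> :: real assume "0 < \<epsilon>"
  obtain U where U: "\<And>u. U \<le> u \<Longrightarrow> \<exists>j. real j + real m * max 0 (u - lev j) \<le> (D + \<epsilon>) * u + 1"
    using ex_good_generation[OF _ \<open>0 < D\<close> D \<open>0 < \<epsilon>\<close>] by auto
  define A where "A = 4 ^ N * ((4 * real m + 2) * real N) ^ m"
  have "0 \<le> A" by (simp add: A_def)
  have bound: "real (covering_number r (orth_proj V ` dust)) \<le> A * 2 ^ N * r powr - (D + \<epsilon>)"
    if r: "0 < r" "r < 2 powr (- (real N * U))" for r
  proof -
    define u where "u = - (log 2 r / real N)"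
    have r_eq: "r = 2 powr (- (real N * u))" using r N_pos by (simp add: u_def)
    have "- (real N * u) < - (real N * U)" using r(2) unfolding r_eq by simp
    then have "U \<le> u" using N_pos by simp
    then obtain j where j: "real j + real m * max 0 (u - lev j) \<le> (D + \<epsilon>) * u + 1" using U by blast
    \<comment> \<open>The projection estimate needs radii of at least \<open>r\<close>. Enlarging
      smaller cubes makes the ratio 1, matching \<open>max 0\<close>.\<close>
    define M where "M = max (len j) r"
    have M: "M / r = 2 powr (real N * max 0 (u - lev j))"
    proof (cases "u \<le> lev j")
      case True
      then have "len j \<le> r" unfolding r_eq len_def by (intro powr_mono) (auto intro: mult_left_mono)
      then show ?thesis using True r by (simp add: M_def)
    next
      case False
      then have "r \<le> len j" unfolding r_eq len_def by (intro powr_mono) (auto intro: mult_left_mono)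
      then have "M / r = 2 powr (- (real N * lev j) - - (real N * u))"
        unfolding powr_diff by (simp add: M_def len_def r_eq)
      then show ?thesis using False by (simp add: algebra_simps)
    qed
    obtain R where R: "(dust :: (real^'n) set) \<subseteq> cball 0 R" using dust_subset_cball by blast
    obtain X :: "(real^'n) set" where X: "finite X" "card X \<le> (4 * 2 ^ j) ^ N"
      "cball 0 R \<inter> dust \<subseteq> (\<Union>p\<in>X. cball p (real N * len j))"
      using dust_cover[where 'n = 'n and x = 0 and R = R and i = 0 and q = j] unfolding card by auto
    have sub: "cball p (real N * len j) \<subseteq> cball p (real N * M)" for p :: "real^'n"
      by (intro subset_cball mult_left_mono) (auto simp: M_def)
    have "dust \<subseteq> (\<Union>p\<in>X. cball p (real N * M))"
      using X(3) R sub by blast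
    moreover have "r \<le> real N * M"
      using N_pos r mult_mono[of 1 "real N" r M] by (simp add: M_def)
    ultimately have "real (covering_number r (orth_proj V ` dust))
        \<le> real (card X) * ((4 * real m + 2) * (real N * M / r)) ^ m"
      using V X(1) r(1) by (intro covering_number_orth_proj_le)
    also have "\<dots> \<le> (4 * 2 ^ j) ^ N * ((4 * real m + 2) * (real N * M / r)) ^ m"
    proof (rule mult_right_mono)
      show "real (card X) \<le> (4 * 2 ^ j) ^ N"
        using X(2) by (rule of_nat_le_power)
      show "0 \<le> ((4 * real m + 2) * (real N * M / r)) ^ m" using r by (simp add: M_def)
    qed
    also have "(4 * real m + 2) * (real N * M / r) = (4 * real m + 2) * real N * 2 powr (real N * max 0 (u - lev j))"
      unfolding M[symmetric] by simp
    also have "(4 * 2 ^ j) ^ N * ((4 * real m + 2) * real N * 2 powr (real N * max 0 (u - lev j))) ^ m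
        = A * 2 powr (real N * (real j + real m * max 0 (u - lev j)))"
    proof -
      have "(2 ^ j) ^ N = (2 :: real) powr (real N * real j)"
        by (rule power_power_eq_powr)
      moreover have "(2 powr (real N * max 0 (u - lev j))) ^ m = 2 powr (real N * (real m * max 0 (u - lev j)))"
        by (simp add: powr_power mult_ac)
      ultimately show ?thesis
        unfolding power_mult_distrib A_def distrib_left powr_add by simp
    qed
    also have "\<dots> \<le> A * 2 powr (real N * ((D + \<epsilon>) * u + 1))"
      using j \<open>0 \<le> A\<close> by (intro mult_left_mono powr_mono) auto
    also have "2 powr (real N * ((D + \<epsilon>) * u + 1)) = 2 ^ N * r powr - (D + \<epsilon>)"
    proof -
      have "real N * ((D + \<epsilon>) * u + 1) = real N + - (real N * u) * - (D + \<epsilon>)"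
        by (simp add: algebra_simps)
      then show ?thesis unfolding r_eq powr_powr by (simp only: powr_add) (simp add: powr_realpow)
    qed
    finally show ?thesis by (simp add: mult.assoc)
  qed
  have "0 < 2 powr (- (real N * U))" by simp
  then show "\<exists>C. \<forall>\<^sub>F r in at_right 0. real (covering_number r (orth_proj V ` dust)) \<le> C * r powr - (D + \<epsilon>)"
    using bound unfolding eventually_at_right[OF \<open>0 < 2 powr (- (real N * U))\<close>] by blast
qed (use assms in simp)

end

section \<open>Dimensions of the dust and of its projections combined\<close>

theorem lemma3p1:
  fixes m :: nat and s t :: real
  assumes "1 \<le> m" and "m < CARD('n::finite)"
    and "real m < s" and "s \<le> real CARD('n)"
    and "0 < t" and "t < s"
  shows "\<exists>F :: (real ^ 'n) set. F \<noteq> {} \<and> compact F \<and>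
    packing_dim F = ereal t \<and> upper_box_dim F = ereal t \<and>
    assouad_dim F = ereal s \<and> quasi_assouad_dim F \<le> ereal s \<and>
    (\<forall>V \<in> grassmannian m.
       packing_dim (orth_proj V ` F) \<le> upper_box_dim (orth_proj V ` F) \<and>
       upper_box_dim (orth_proj V ` F)
         \<le> ereal (real m * s * t / (real m * (s - t) + s * t)) \<and>
       real m * s * t / (real m * (s - t) + s * t) < min t (real m))"
proof -
  interpret fact_blocks "CARD('n)" s t
    using assms by unfold_locales auto
  define F :: "(real^'n) set" where "F = dust"
  define D where "D = real m * s * t / (real m * (s - t) + s * t)"
  have F: "compact F" "F \<noteq> {}"
    using compact_dust zero_in_dust by (auto simp: F_def)
  \<comment> \<open>This local bound gives the box dimension with \<open>G = F\<close> and, through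
    Baire's theorem, the packing dimension.\<close>
  have ge: "ereal t \<le> upper_box_dim G" if "compact G" "y \<in> F" "0 < e" "F \<inter> ball y e \<subseteq> G" for G y e
    using that upper_box_dim_ge_of_dust[OF refl, of G y e] by (simp add: F_def compact_imp_bounded)
  have box: "upper_box_dim F = ereal t"
    using upper_box_dim_dust_le[where 'n = 'n] ge[of F 0 1] F zero_in_dust
    by (intro antisym) (auto simp: F_def)
  moreover have "packing_dim F = ereal t"
    using packing_dim_le_upper_box_dim[OF F(1)] packing_dim_ge[OF F ge] box by (intro antisym) auto
  moreover have ass: "assouad_dim F = ereal s"
    unfolding F_def by (intro antisym assouad_dim_dust_le assouad_dim_dust_ge) auto
  moreover have "quasi_assouad_dim F \<le> ereal s"
    using quasi_assouad_dim_le_assouad_dim[of F] ass by simp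
  moreover have m: "0 < real m" using assms by simp
  have pos: "0 < real m * (s - t) + s * t"
    using assms m by (intro add_pos_pos mult_pos_pos) auto
  have "D < min t (real m)"
  proof -
    \<comment> \<open>\<open>D < t\<close> rests on \<open>m < s\<close>, and \<open>D < m\<close>
      on \<open>t < s\<close>.\<close>
    have "real m * t < s * t" using assms by simp
    then have "real m * s < real m * (s - t) + s * t" by (simp add: algebra_simps)
    then have "t * (real m * s) < t * (real m * (s - t) + s * t)" using assms by simp
    then have "D < t" using pos by (simp add: D_def pos_divide_less_eq mult_ac)
    have "0 < real m * (s - t)" using assms m by simp
    then have "real m * (s * t) < real m * (real m * (s - t) + s * t)" using m by simp
    then have "D < real m" using pos by (simp add: D_def pos_divide_less_eq mult_ac)
    with \<open>D < t\<close> show ?thesis by simp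
  qed
  moreover have "upper_box_dim (orth_proj V ` F) \<le> ereal D" if "V \<in> grassmannian m" for V
    unfolding F_def
  proof (rule upper_box_dim_proj_dust_le)
    show "subspace V" "dim V = m" using that by (auto simp: grassmannian_def)
    show "0 < D" using pos assms m by (simp add: D_def)
    have "(real m * c + 1) * (s * t) = real m * (s - t) + s * t"
      using assms s_pos by (simp add: c_def field_simps)
    moreover have "D * (real m * c + 1) = real m * ((real m * c + 1) * (s * t)) / (real m * (s - t) + s * t)"
      by (simp add: D_def mult_ac)
    ultimately show "real m = D * (real m * c + 1)"
      using pos by simp
  qed simp
  moreover have "packing_dim (orth_proj V ` F) \<le> upper_box_dim (orth_proj V ` F)"
    if "V \<in> grassmannian m" for V
    using that F(1)
    by (intro packing_dim_le_upper_box_dim compact_orth_proj_image) (auto simp: grassmannian_def)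
  ultimately show ?thesis
    using F unfolding D_def by (intro exI[of _ F]) blast
qed

end
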